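(* Let $r$ be a graphon that is continuous, bounded away from $0$ and $1$ (there is $\delta>0$ with $\delta\le r\le1-\delta$), and non-negative definite (i.e. the integral operator $\mathcal T_r$ on $L^2([0,1])$, $(\mathcal T_ru)(x)=\int_{[0,1]}r(x,y)u(y)\,dy$, is non-negative definite). Let $C_r=\|\mathcal L_r\|$ and $\widehat\psi_r(\beta)=\inf_{x\in[0,1]}J_r(x,\beta)$ for $\beta\in[C_r,1]$. Then $$\widehat\psi_r(\beta)\sim\widehat K_r(\beta-C_r)^2,\qquad\beta\downarrow C_r,$$ with $$\widehat K_r=\frac12\inf_{x\in\mathcal D_r}\frac1{v_r(x)},$$ where $\mathcal D_r=\{x\in[0,1]\colon d_r(x)=\|d_r\|_\infty\}$, $d_r(x)=\int_{[0,1]}r(x,y)\,dy$ and $v_r(x)=\int_{[0,1]}r(x,y)[1-r(x,y)]\,dy$.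
   Context: A graphon is a measurable function $h\colon[0,1]^2\to[0,1]$ with $h(x,y)=h(y,x)$ for all $x,y$. The Laplacian operator $\mathcal L_h$ on $L^2([0,1])$ is $(\mathcal L_hu)(x)=\int_{[0,1]}h(x,y)[u(x)-u(y)]\,dy$, and $\|\mathcal L_h\|$ is its operator norm. Rate function: $\mathcal R(a\mid b)=a\log\frac ab+(1-a)\log\frac{1-a}{1-b}$ for $a\in[0,1]$, $b\in(0,1)$, with $0\log0=0$. For $x\in[0,1]$, $$J_r(x,\beta)=\int_{[0,1]}\mathcal R\big(\widehat r_\beta(x,y)\mid r(x,y)\big)\,dy,\qquad \widehat r_\beta(x,y)=\frac{e^{\theta(x,\beta)}r(x,y)}{e^{\theta(x,\beta)}r(x,y)+[1-r(x,y)]},$$ where $\theta(x,\beta)$ is chosen such that $\int_{[0,1]}\widehat r_\beta(x,y)\,dy=\beta$ for every $x\in[0,1]$. For $\beta=1$ one takes $\theta(x,1)=\infty$, i.e. $\widehat r_1\equiv1$. $f(\beta)\sim g(\beta)$ as $\beta\downarrow C_r$ means $f(\beta)/g(\beta)\to1$. *)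

theory Defs
  imports "HOL-Probability.Essential_Supremum"
begin

abbreviation unit_measure :: "real measure" where
  "unit_measure \<equiv> restrict_space lborel {0..1}"

definition graphon :: "(real \<Rightarrow> real \<Rightarrow> real) \<Rightarrow> bool" where
  "graphon h \<longleftrightarrow>
     (\<lambda>(x, y). h x y) \<in> borel_measurable (unit_measure \<Otimes>\<^sub>M unit_measure) \<and>
     (\<forall>x\<in>{0..1}. \<forall>y\<in>{0..1}. 0 \<le> h x y \<and> h x y \<le> 1 \<and> h x y = h y x)"

(* Elements of L2([0,1]) are represented by real-valued functions, not by classes modulo null
   sets. Borel representatives suffice: every Lebesgue measurable function agrees almost
   everywhere with a Borel one. *)
definition L2_unit :: "(real \<Rightarrow> real) set" where
  "L2_unit = {u \<in> borel_measurable unit_measure. integrable unit_measure (\<lambda>x. (u x)\<^sup>2)}"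

definition L2_inner :: "(real \<Rightarrow> real) \<Rightarrow> (real \<Rightarrow> real) \<Rightarrow> real" where
  "L2_inner u v = (\<integral>x. u x * v x \<partial>unit_measure)"

definition L2_norm :: "(real \<Rightarrow> real) \<Rightarrow> real" where
  "L2_norm u = sqrt (L2_inner u u)"

(* Same shape as the constant onorm, which needs a normed vector space type.
   Functions of norm 0 contribute the quotient x / 0 = 0. *)
definition L2_onorm :: "((real \<Rightarrow> real) \<Rightarrow> real \<Rightarrow> real) \<Rightarrow> real" where
  "L2_onorm T = (SUP u\<in>L2_unit. L2_norm (T u) / L2_norm u)"

definition laplacian_op :: "(real \<Rightarrow> real \<Rightarrow> real) \<Rightarrow> (real \<Rightarrow> real) \<Rightarrow> real \<Rightarrow> real" where
  "laplacian_op h u x = (\<integral>y. h x y * (u x - u y) \<partial>unit_measure)"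

definition kernel_op :: "(real \<Rightarrow> real \<Rightarrow> real) \<Rightarrow> (real \<Rightarrow> real) \<Rightarrow> real \<Rightarrow> real" where
  "kernel_op r u x = (\<integral>y. r x y * u y \<partial>unit_measure)"

definition nonneg_definite :: "((real \<Rightarrow> real) \<Rightarrow> real \<Rightarrow> real) \<Rightarrow> bool" where
  "nonneg_definite T \<longleftrightarrow> (\<forall>u\<in>L2_unit. 0 \<le> L2_inner u (T u))"

definition Linf_norm :: "(real \<Rightarrow> real) \<Rightarrow> ereal" where
  "Linf_norm f = esssup unit_measure (\<lambda>x. ereal \<bar>f x\<bar>)"

(* The convention 0 log 0 = 0 holds because the factor in front of the logarithm vanishes. *)
definition rel_entropy :: "real \<Rightarrow> real \<Rightarrow> real" where
  "rel_entropy a b = a * ln (a / b) + (1 - a) * ln ((1 - a) / (1 - b))"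

definition tilt :: "real \<Rightarrow> real \<Rightarrow> real" where
  "tilt t p = exp t * p / (exp t * p + (1 - p))"

definition theta :: "(real \<Rightarrow> real \<Rightarrow> real) \<Rightarrow> real \<Rightarrow> real \<Rightarrow> real" where
  "theta r x \<beta> = (SOME t. (\<integral>y. tilt t (r x y) \<partial>unit_measure) = \<beta>)"

(* For \<beta> = 1 no finite tilting parameter exists when r < 1; the value 1 is the limit of the
   tilt as the parameter tends to infinity. *)
definition r_hat :: "(real \<Rightarrow> real \<Rightarrow> real) \<Rightarrow> real \<Rightarrow> real \<Rightarrow> real \<Rightarrow> real" where
  "r_hat r \<beta> x y = (if \<beta> = 1 then 1 else tilt (theta r x \<beta>) (r x y))"

definition J :: "(real \<Rightarrow> real \<Rightarrow> real) \<Rightarrow> real \<Rightarrow> real \<Rightarrow> real" where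
  "J r x \<beta> = (\<integral>y. rel_entropy (r_hat r \<beta> x y) (r x y) \<partial>unit_measure)"

definition C :: "(real \<Rightarrow> real \<Rightarrow> real) \<Rightarrow> real" where
  "C r = L2_onorm (laplacian_op r)"

(* Meaningful for C r \<le> \<beta> \<le> 1; for \<beta> > 1 no tilting parameter exists. *)
definition psi_hat :: "(real \<Rightarrow> real \<Rightarrow> real) \<Rightarrow> real \<Rightarrow> real" where
  "psi_hat r \<beta> = (INF x\<in>{0..1}. J r x \<beta>)"

definition deg :: "(real \<Rightarrow> real \<Rightarrow> real) \<Rightarrow> real \<Rightarrow> real" where
  "deg r x = (\<integral>y. r x y \<partial>unit_measure)"

definition max_deg_set :: "(real \<Rightarrow> real \<Rightarrow> real) \<Rightarrow> real set" where
  "max_deg_set r = {x \<in> {0..1}. ereal (deg r x) = Linf_norm (deg r)}"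

definition var :: "(real \<Rightarrow> real \<Rightarrow> real) \<Rightarrow> real \<Rightarrow> real" where
  "var r x = (\<integral>y. r x y * (1 - r x y) \<partial>unit_measure)"

definition K_hat :: "(real \<Rightarrow> real \<Rightarrow> real) \<Rightarrow> real" where
  "K_hat r = 1 / 2 * (INF x\<in>max_deg_set r. 1 / var r x)"

end

theory Submission
  imports Defs "HOL-Probability.Probability_Measure"
begin

text \<open>Positivity of the integral operator gives \<open>\<langle>u, L u\<rangle> \<le> \<langle>u, d u\<rangle>\<close>, whence \<open>C r\<close> is at
  most, and by localisation equal to, the maximal degree \<open>M\<close>. The tilted kernel attains equality in Young's inequality between the
  relative entropy and the cumulant generating function \<open>log (e\<^sup>t p + 1 - p)\<close>, so
  \<open>J r x \<beta>\<close> is both a supremum over \<open>t\<close> (dual problem) and an infimum over kernels of mean \<open>\<beta>\<close>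
  (primal problem). With \<open>V\<close> the largest variance on the set of maximal degree and
  \<open>t = (\<beta> - M) / V\<close>, inserting \<open>t\<close> in the dual problem, uniformly in \<open>x\<close>, and \<open>r + t r (1 - r)\<close>
  in the primal problem, at one maximiser of the variance, gives matching bounds
  \<open>(\<beta> - M)\<^sup>2 / (2 V)\<close>. Points of large variance outside the set of maximal degree are harmless, since
  by compactness their degree stays away from \<open>M\<close>.\<close>

section \<open>Integration and continuity on the unit interval\<close>

lemma prob_space_unit: "prob_space unit_measure"
  by (rule prob_space_restrict_space) auto

interpretation unit: prob_space unit_measure
  by (rule prob_space_unit)

interpretation unit_pair: pair_sigma_finite unit_measure unit_measure ..

lemma space_unit [simp]: "space unit_measure = {0..1}"
  by (simp add: space_restrict_space)

lemma AE_unit: "(\<And>x. x \<in> {0..1} \<Longrightarrow> P x) \<Longrightarrow> AE x in unit_measure. P x"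
  by (rule AE_I2) auto

lemma borel_measurable_unit:
  fixes f :: "real \<Rightarrow> real"
  assumes "continuous_on {0..1} f"
  shows "f \<in> borel_measurable unit_measure"
  using borel_measurable_continuous_on_restrict[OF assms]
  by (simp cong: measurable_cong_sets add: sets_restrict_space)

lemma integrable_unit_bounded:
  fixes f :: "real \<Rightarrow> real"
  assumes "f \<in> borel_measurable unit_measure" "\<And>x. x \<in> {0..1} \<Longrightarrow> \<bar>f x\<bar> \<le> B"
  shows "integrable unit_measure f"
  using assms by (intro unit.integrable_const_bound[of _ B] AE_unit) auto

lemma integrable_unit_continuous:
  fixes f :: "real \<Rightarrow> real"
  assumes "continuous_on {0..1} f"
  shows "integrable unit_measure f"
proof -
  have "compact (f ` {0..1})"
    using assms by (rule compact_continuous_image) auto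
  then obtain B where "\<And>x. x \<in> {0..1} \<Longrightarrow> norm (f x) \<le> B"
    by (metis bounded_iff compact_imp_bounded imageI)
  then show ?thesis
    by (intro integrable_unit_bounded[OF borel_measurable_unit[OF assms]]) auto
qed

lemma integral_unit_mono:
  fixes f g :: "real \<Rightarrow> real"
  assumes "integrable unit_measure f" "integrable unit_measure g"
    "\<And>x. x \<in> {0..1} \<Longrightarrow> f x \<le> g x"
  shows "(\<integral>x. f x \<partial>unit_measure) \<le> (\<integral>x. g x \<partial>unit_measure)"
  using assms by (intro integral_mono) auto

lemma measure_unit [simp]: "measure unit_measure {0..1} = 1"
  using unit.prob_space by simp

lemma integral_unit_eq_integral:
  fixes f :: "real \<Rightarrow> real"
  assumes "continuous_on {0..1} f"
  shows "(\<integral>x. f x \<partial>unit_measure) = integral {0..1} f"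
proof -
  have "set_integrable lborel {0..1} f"
    using borel_integrable_compact[OF _ assms] by (simp add: set_integrable_def)
  from set_borel_integral_eq_integral(2)[OF this] show ?thesis
    by (simp add: integral_restrict_space set_lebesgue_integral_def)
qed

lemma continuous_on_section:
  assumes "continuous_on (U \<times> V) (\<lambda>(x, y). f x y)" "x \<in> U"
  shows "continuous_on V (f x)"
proof -
  have "continuous_on V (\<lambda>y. case (x, y) of (x, y) \<Rightarrow> f x y)"
    by (rule continuous_on_compose2[OF assms(1)]) (use assms(2) in \<open>auto intro!: continuous_intros\<close>)
  then show ?thesis by simp
qed

text \<open>On continuous integrands the integral over \<open>unit_measure\<close> is the gauge
  integral, for which \<open>integral_continuous_on_param\<close> gives continuity in the
  parameter.\<close>

lemma continuous_on_integral_unit: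
  fixes f :: "'a::topological_space \<Rightarrow> real \<Rightarrow> real"
  assumes "continuous_on (U \<times> {0..1}) (\<lambda>(x, y). f x y)"
  shows "continuous_on U (\<lambda>x. \<integral>y. f x y \<partial>unit_measure)"
proof -
  have "continuous_on U (\<lambda>x. integral (cbox 0 1) (f x))"
    by (rule integral_continuous_on_param) (use assms in simp)
  then show ?thesis
    by (rule continuous_on_eq) (simp add: integral_unit_eq_integral continuous_on_section[OF assms])
qed

lemma measure_unit_interval:
  assumes "0 \<le> a" "a \<le> b" "b \<le> 1"
  shows "measure unit_measure {a..b} = b - a"
  using assms by (subst measure_restrict_space) auto

lemma interval_in_sets_unit:
  assumes "0 \<le> a" "b \<le> (1::real)"
  shows "{a..b} \<in> sets unit_measure"
  using assms by (subst sets_restrict_space_iff) auto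

section \<open>Relative entropy\<close>

text \<open>The difference of the two sides has derivative \<open>y ^ 3 / (1 + y)\<close>, which has
  the sign of \<open>y\<close>, so its minimum over \<open>y > -1\<close> is the value 0 at
  0.\<close>

lemma ln_one_plus_le_cubic:
  fixes x :: real
  assumes "-1 < x"
  shows "ln (1 + x) \<le> x - x\<^sup>2 / 2 + x ^ 3 / 3"
proof -
  define g where "g = (\<lambda>x::real. x - x\<^sup>2 / 2 + x ^ 3 / 3 - ln (1 + x))"
  have der: "(g has_real_derivative (y ^ 3 / (1 + y))) (at y)" if "-1 < y" for y
    unfolding g_def using that
    by (auto intro!: derivative_eq_intros simp: field_simps power2_eq_square power3_eq_cube)
  have g0: "g 0 = 0" by (simp add: g_def)
  have "0 \<le> g x"
  proof (cases "0 \<le> x")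
    case True
    have "g 0 \<le> g x"
    proof (rule DERIV_nonneg_imp_nondecreasing[OF True])
      fix y :: real assume "0 \<le> y" "y \<le> x"
      then show "\<exists>z. (g has_real_derivative z) (at y) \<and> 0 \<le> z"
        using der[of y] by (intro exI[of _ "y ^ 3 / (1 + y)"]) auto
    qed
    then show ?thesis by (simp add: g0)
  next
    case False
    then have x: "x \<le> 0" by simp
    have "g 0 \<le> g x"
    proof (rule DERIV_nonpos_imp_nonincreasing[OF x])
      fix y assume "x \<le> y" "y \<le> 0"
      then show "\<exists>z. (g has_real_derivative z) (at y) \<and> z \<le> 0"
        using der[of y] assms by (intro exI[of _ "y ^ 3 / (1 + y)"])
          (auto simp: divide_nonpos_pos power3_eq_cube mult_nonneg_nonpos)
    qed
    then show ?thesis by (simp add: g0)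
  qed
  then show ?thesis by (simp add: g_def)
qed

lemma xlnx_le_cubic:
  fixes x :: real
  assumes "\<bar>x\<bar> < 1"
  shows "(1 + x) * ln (1 + x) \<le> x + x\<^sup>2 / 2 + \<bar>x\<bar> ^ 3"
proof -
  have "(1 + x) * ln (1 + x) \<le> (1 + x) * (x - x\<^sup>2 / 2 + x ^ 3 / 3)"
    using assms by (intro mult_left_mono ln_one_plus_le_cubic) auto
  also have "\<dots> = x + x\<^sup>2 / 2 - x ^ 3 / 6 + x ^ 3 * x / 3"
    by (simp add: field_simps power2_eq_square power3_eq_cube)
  also have "\<dots> \<le> x + x\<^sup>2 / 2 + \<bar>x\<bar> ^ 3"
  proof -
    have "- (x ^ 3) \<le> \<bar>x\<bar> ^ 3" by (simp add: power_abs[symmetric] abs_ge_minus_self)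
    moreover have "x ^ 3 * x \<le> \<bar>x\<bar> ^ 3"
    proof -
      have "x ^ 3 * x \<le> \<bar>x ^ 3\<bar> * \<bar>x\<bar>" by (metis abs_ge_self abs_mult)
      also have "\<dots> \<le> \<bar>x ^ 3\<bar> * 1" using assms by (intro mult_left_mono) auto
      finally show ?thesis by (simp add: power_abs)
    qed
    moreover have "0 \<le> \<bar>x\<bar> ^ 3" by simp
    ultimately show ?thesis by linarith
  qed
  finally show ?thesis .
qed

text \<open>The cumulant generating function of a Bernoulli variable with success probability
  \<open>p\<close>. For \<open>0 < p < 1\<close> its derivative in \<open>t\<close> is
  \<open>tilt t p\<close>, and its convex conjugate is \<open>rel_entropy q p\<close> as a function
  of \<open>q\<close>.\<close>

definition cgf :: "real \<Rightarrow> real \<Rightarrow> real" where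
  "cgf t p = ln (exp t * p + (1 - p))"

lemma cgf_arg_pos:
  fixes p t :: real
  assumes "0 < p" "p < 1"
  shows "0 < exp t * p + (1 - p)"
proof -
  have "0 < exp t * p" using assms(1) by simp
  then show ?thesis using assms by linarith
qed

lemma tilt_bounds:
  assumes "0 < p" "p < 1"
  shows "0 < tilt t p" "tilt t p < 1"
  using assms cgf_arg_pos[OF assms, of t] by (auto simp: tilt_def)

text \<open>Young's inequality for this dual pair: the gap is the relative entropy of
  \<open>q\<close> with respect to \<open>tilt t p\<close>, non-negative by Gibbs' inequality, that
  is, by \<open>ln z \<le> z - 1\<close> applied to both ratios of weights.\<close>

lemma rel_entropy_ge_legendre:
  assumes "0 < p" "p < 1" "0 < q" "q < 1"
  shows "t * q - cgf t p \<le> rel_entropy q p"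
proof -
  let ?Z = "exp t * p + (1 - p)"
  let ?a = "exp t * p / ?Z" and ?b = "(1 - p) / ?Z"
  have Z: "0 < ?Z" using assms by (intro cgf_arg_pos)
  have a: "0 < ?a" and b: "0 < ?b" using assms Z by auto
  have ab: "?a + ?b = 1" using Z by (simp add: add_divide_distrib[symmetric])
  have "q * ln (?a / q) \<le> q * (?a / q - 1)"
    using divide_pos_pos[OF a assms(3)] assms by (intro mult_left_mono ln_le_minus_one) auto
  moreover have "(1 - q) * ln (?b / (1 - q)) \<le> (1 - q) * (?b / (1 - q) - 1)"
    using divide_pos_pos[OF b, of "1 - q"] assms by (intro mult_left_mono ln_le_minus_one) auto
  moreover have "q * (?a / q - 1) + (1 - q) * (?b / (1 - q) - 1) = 0"
  proof -
    have cancel: "c * (x / c - 1) = x - c" if "c \<noteq> 0" for c x :: real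
      using that by (simp add: field_simps)
    show ?thesis using ab assms by (subst (1 2) cancel) auto
  qed
  moreover have "ln (?a / q) = t + ln p - ln ?Z - ln q"
    using assms Z by (simp add: ln_div ln_mult)
  moreover have "ln (?b / (1 - q)) = ln (1 - p) - ln ?Z - ln (1 - q)"
    using assms Z by (simp add: ln_div ln_mult)
  ultimately have "q * (t + ln p - ln ?Z - ln q) + (1 - q) * (ln (1 - p) - ln ?Z - ln (1 - q)) \<le> 0"
    by simp
  moreover have "rel_entropy q p = q * (ln q - ln p) + (1 - q) * (ln (1 - q) - ln (1 - p))"
    using assms by (simp add: rel_entropy_def ln_div)
  ultimately show ?thesis by (simp add: cgf_def algebra_simps)
qed

text \<open>The equality case of \<open>rel_entropy_ge_legendre\<close>: both logarithms share the
  normalisation \<open>?Z\<close>.\<close>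

lemma rel_entropy_tilt:
  assumes "0 < p" "p < 1"
  shows "rel_entropy (tilt t p) p = t * tilt t p - cgf t p"
proof -
  let ?Z = "exp t * p + (1 - p)"
  have Z: "0 < ?Z" using assms by (intro cgf_arg_pos)
  have 1: "tilt t p / p = exp t / ?Z" using assms by (simp add: tilt_def)
  have 2: "(1 - tilt t p) / (1 - p) = 1 / ?Z"
  proof -
    have "1 - tilt t p = (?Z - exp t * p) / ?Z"
      using Z by (simp only: tilt_def diff_divide_distrib[of ?Z] divide_self)
    then show ?thesis using assms by simp
  qed
  have "rel_entropy (tilt t p) p = tilt t p * (t - ln ?Z) + (1 - tilt t p) * (- ln ?Z)"
    unfolding rel_entropy_def 1 2 using Z by (simp add: ln_div)
  then show ?thesis by (simp add: cgf_def algebra_simps)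
qed

text \<open>The generous cubic coefficient 1 makes the derivative of the gap
  \<open>1 + x + 3 * x\<^sup>2 - exp x\<close>, which is non-negative on the unit interval by
  \<open>exp_bound\<close>.\<close>

lemma exp_le_cubic:
  fixes t :: real
  assumes "0 \<le> t" "t \<le> 1"
  shows "exp t \<le> 1 + t + t\<^sup>2 / 2 + t ^ 3"
proof -
  define g where "g = (\<lambda>x::real. 1 + x + x\<^sup>2 / 2 + x ^ 3 - exp x)"
  have "g 0 \<le> g t"
  proof (rule DERIV_nonneg_imp_nondecreasing[OF assms(1)])
    fix x :: real assume x: "0 \<le> x" "x \<le> t"
    have "(g has_real_derivative (1 + x + 3 * x\<^sup>2 - exp x)) (at x)"
      unfolding g_def by (auto intro!: derivative_eq_intros)
    moreover have "exp x \<le> 1 + x + x\<^sup>2" using x assms by (intro exp_bound) auto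
    ultimately show "\<exists>y. (g has_real_derivative y) (at x) \<and> 0 \<le> y"
      by (intro exI[of _ "1 + x + 3 * x\<^sup>2 - exp x"]) (auto simp: order_trans[OF _ add_left_mono])
  qed
  then show ?thesis by (simp add: g_def)
qed

text \<open>A second-order expansion at \<open>t = 0\<close> with an error independent of
  \<open>p\<close>, so that it can be integrated along a section of the kernel. It comes from
  expanding \<open>ln (1 + w)\<close> with \<open>w = p * (exp t - 1)\<close>.\<close>

lemma cgf_le_cubic:
  assumes "0 < p" "p < 1" "0 \<le> t" "t \<le> 1"
  shows "cgf t p \<le> t * p + t\<^sup>2 / 2 * (p * (1 - p)) + 4 * t ^ 3"
proof -
  define w where "w = p * (exp t - 1)"
  have e1: "t \<le> exp t - 1" using exp_ge_add_one_self[of t] by linarith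
  have "exp t \<le> 1 + t + t\<^sup>2" using assms by (intro exp_bound) auto
  moreover have "t\<^sup>2 \<le> t" using assms by (simp add: power2_eq_square mult_left_le)
  ultimately have e2: "exp t - 1 \<le> 2 * t" by linarith
  have w1: "p * t \<le> w" unfolding w_def using assms e1 by (intro mult_left_mono) auto
  have w0: "0 \<le> w" using w1 assms by (meson mult_nonneg_nonneg less_imp_le order_trans)
  have "w \<le> 1 * (2 * t)" unfolding w_def using assms e1 e2 by (intro mult_mono) auto
  then have "w ^ 3 \<le> (2 * t) ^ 3" using w0 by (intro power_mono) auto
  then have w3: "w ^ 3 \<le> 8 * t ^ 3" by (simp add: power_mult_distrib)
  \<comment> \<open>The lower bound on \<open>w\<close> is what subtracts
    \<open>(p * t)\<^sup>2 / 2\<close> and so turns the second moment \<open>p\<close> into the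
    variance \<open>p * (1 - p)\<close>.\<close>
  have w2: "(p * t)\<^sup>2 \<le> w\<^sup>2" using w1 assms by (intro power_mono) auto
  have "w \<le> p * (t + t\<^sup>2 / 2 + t ^ 3)"
    unfolding w_def using assms exp_le_cubic[of t] by (intro mult_left_mono) auto
  also have "\<dots> = p * t + p * t\<^sup>2 / 2 + p * t ^ 3" by (simp add: algebra_simps)
  also have "p * t ^ 3 \<le> t ^ 3" using assms by (simp add: mult_left_le_one_le)
  finally have ww: "w \<le> p * t + p * t\<^sup>2 / 2 + t ^ 3" by simp
  have "cgf t p = ln (1 + w)" by (simp add: cgf_def w_def algebra_simps)
  also have "\<dots> \<le> w - w\<^sup>2 / 2 + w ^ 3 / 3" using w0 by (intro ln_one_plus_le_cubic) auto
  also have "\<dots> \<le> (p * t + p * t\<^sup>2 / 2 + t ^ 3) - (p * t)\<^sup>2 / 2 + 8 * t ^ 3 / 3"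
    using ww w2 w3 by linarith
  also have "\<dots> = t * p + t\<^sup>2 / 2 * (p * (1 - p)) + 11 / 3 * t ^ 3"
    by (simp add: field_simps power2_eq_square)
  also have "\<dots> \<le> t * p + t\<^sup>2 / 2 * (p * (1 - p)) + 4 * t ^ 3"
    using assms by (intro add_left_mono mult_right_mono) auto
  finally show ?thesis .
qed

text \<open>The weights \<open>p\<close> and \<open>1 - p\<close> change by the factors
  \<open>1 + ?x\<close> and \<open>1 + ?y\<close>. The weighted first-order terms cancel, and the
  weighted squares add up to \<open>h\<^sup>2 * (p * (1 - p))\<close>.\<close>

lemma rel_entropy_le_cubic:
  assumes "0 < p" "p < 1" "0 \<le> h" "h < 1"
  shows "rel_entropy (p + h * (p * (1 - p))) p \<le> h\<^sup>2 / 2 * (p * (1 - p)) + h ^ 3"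
proof -
  let ?x = "h * (1 - p)" and ?y = "- (h * p)"
  have x: "\<bar>?x\<bar> < 1" and y: "\<bar>?y\<bar> < 1"
    using assms mult_left_le[of p h] mult_left_le[of "1 - p" h]
    by (auto simp: abs_mult)
  have x3: "\<bar>?x\<bar> ^ 3 \<le> h ^ 3" and y3: "\<bar>?y\<bar> ^ 3 \<le> h ^ 3"
    using assms by (auto intro!: power_mono simp: abs_mult mult_left_le)
  have eq1: "(p + h * (p * (1 - p))) / p = 1 + ?x"
    using assms by (simp add: field_simps)
  have eq2: "(1 - (p + h * (p * (1 - p)))) / (1 - p) = 1 + ?y"
    using assms by (simp add: field_simps)
  have "rel_entropy (p + h * (p * (1 - p))) p
      = p * ((1 + ?x) * ln (1 + ?x)) + (1 - p) * ((1 + ?y) * ln (1 + ?y))"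
    unfolding rel_entropy_def eq1 eq2 by (simp add: algebra_simps)
  also have "\<dots> \<le> p * (?x + ?x\<^sup>2 / 2 + h ^ 3) + (1 - p) * (?y + ?y\<^sup>2 / 2 + h ^ 3)"
    using xlnx_le_cubic[OF x] xlnx_le_cubic[OF y] x3 y3 assms
    by (intro add_mono mult_left_mono) linarith+
  also have "\<dots> = h\<^sup>2 / 2 * (p * (1 - p)) + h ^ 3"
    by (simp add: field_simps power2_eq_square)
  finally show ?thesis .
qed

section \<open>The norm of the Laplacian\<close>

lemma L2_unitD:
  assumes "u \<in> L2_unit"
  shows "u \<in> borel_measurable unit_measure" "integrable unit_measure (\<lambda>x. (u x)\<^sup>2)"
    "integrable unit_measure u"
proof -
  show 1: "u \<in> borel_measurable unit_measure" "integrable unit_measure (\<lambda>x. (u x)\<^sup>2)"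
    using assms by (auto simp: L2_unit_def)
  from unit.square_integrable_imp_integrable[OF this]
  show "integrable unit_measure u" .
qed

lemma L2_unit_bounded:
  assumes "u \<in> borel_measurable unit_measure" "\<And>x. x \<in> {0..1} \<Longrightarrow> \<bar>u x\<bar> \<le> B"
  shows "u \<in> L2_unit"
proof -
  have "\<bar>(u x)\<^sup>2\<bar> \<le> B\<^sup>2" if "x \<in> {0..1}" for x
    using power_mono[OF assms(2)[OF that], of 2] by simp
  then have "integrable unit_measure (\<lambda>x. (u x)\<^sup>2)"
    using assms(1) by (intro integrable_unit_bounded[of _ "B\<^sup>2"]) auto
  then show ?thesis using assms(1) by (simp add: L2_unit_def)
qed

lemma L2_integrable_mult:
  assumes "u \<in> L2_unit" "v \<in> L2_unit"
  shows "integrable unit_measure (\<lambda>x. u x * v x)"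
proof (rule Bochner_Integration.integrable_bound)
  show "integrable unit_measure (\<lambda>x. (u x)\<^sup>2 + (v x)\<^sup>2)"
    using L2_unitD(2) assms by (intro Bochner_Integration.integrable_add)
  show "(\<lambda>x. u x * v x) \<in> borel_measurable unit_measure"
    using L2_unitD(1)[OF assms(1)] L2_unitD(1)[OF assms(2)] by measurable
  have "\<bar>a * b\<bar> \<le> a\<^sup>2 + b\<^sup>2" for a b :: real
  proof -
    have "2 * \<bar>a * b\<bar> \<le> a\<^sup>2 + b\<^sup>2"
      using zero_le_power2[of "\<bar>a\<bar> - \<bar>b\<bar>"] by (simp add: power2_diff abs_mult)
    then show ?thesis using abs_ge_zero[of "a * b"] by linarith
  qed
  then show "AE x in unit_measure. norm (u x * v x) \<le> norm ((u x)\<^sup>2 + (v x)\<^sup>2)"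
    by (auto simp: abs_mult)
qed

lemma L2_unit_diff_scale:
  assumes "u \<in> L2_unit" "v \<in> L2_unit"
  shows "(\<lambda>x. u x - c * v x) \<in> L2_unit"
proof -
  have "integrable unit_measure (\<lambda>x. (u x)\<^sup>2 - 2 * c * (u x * v x) + c\<^sup>2 * (v x)\<^sup>2)"
    using L2_unitD(2) L2_integrable_mult assms
    by (intro Bochner_Integration.integrable_add Bochner_Integration.integrable_diff
        Bochner_Integration.integrable_mult_right)
  moreover have "(\<lambda>x. (u x)\<^sup>2 - 2 * c * (u x * v x) + c\<^sup>2 * (v x)\<^sup>2) = (\<lambda>x. (u x - c * v x)\<^sup>2)"
    by (simp add: fun_eq_iff power2_diff power_mult_distrib)
  ultimately show ?thesis
    using L2_unitD(1)[OF assms(1)] L2_unitD(1)[OF assms(2)] by (simp add: L2_unit_def)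
qed

lemma L2_inner_commute: "L2_inner u v = L2_inner v u"
  by (simp add: L2_inner_def mult.commute)

lemma L2_inner_cong:
  "(\<And>x. x \<in> {0..1} \<Longrightarrow> u x = u' x) \<Longrightarrow> (\<And>x. x \<in> {0..1} \<Longrightarrow> v x = v' x)
    \<Longrightarrow> L2_inner u v = L2_inner u' v'"
  unfolding L2_inner_def by (intro Bochner_Integration.integral_cong) auto

lemma L2_inner_diff_scale:
  assumes "u \<in> L2_unit" "v \<in> L2_unit" "w \<in> L2_unit"
  shows "L2_inner (\<lambda>x. u x - c * v x) w = L2_inner u w - c * L2_inner v w"
proof -
  have "L2_inner (\<lambda>x. u x - c * v x) w = (\<integral>x. u x * w x - c * (v x * w x) \<partial>unit_measure)"
    by (simp add: L2_inner_def algebra_simps)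
  also have "\<dots> = L2_inner u w - c * L2_inner v w"
    using L2_integrable_mult assms by (simp add: L2_inner_def)
  finally show ?thesis .
qed

lemma L2_inner_self_nonneg: "0 \<le> L2_inner u u"
  by (simp add: L2_inner_def Bochner_Integration.integral_nonneg)

lemma integrable_pair_unit_mult:
  fixes f g :: "real \<Rightarrow> real"
  assumes f: "integrable unit_measure f" and g: "integrable unit_measure g"
  shows "integrable (unit_measure \<Otimes>\<^sub>M unit_measure) (\<lambda>(x, y). f x * g y)"
proof (rule unit_pair.Fubini_integrable)
  have [measurable]: "f \<in> borel_measurable unit_measure" "g \<in> borel_measurable unit_measure"
    using f g by auto
  show "(\<lambda>(x, y). f x * g y) \<in> borel_measurable (unit_measure \<Otimes>\<^sub>M unit_measure)"
    by measurable
  have "(\<lambda>x. \<integral>y. norm (case (x, y) of (x, y) \<Rightarrow> f x * g y) \<partial>unit_measure)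
      = (\<lambda>x. \<bar>f x\<bar> * (\<integral>y. \<bar>g y\<bar> \<partial>unit_measure))"
    by (simp add: abs_mult)
  then show "integrable unit_measure
      (\<lambda>x. \<integral>y. norm (case (x, y) of (x, y) \<Rightarrow> f x * g y) \<partial>unit_measure)"
    using f by (simp only:) (intro Bochner_Integration.integrable_mult_left integrable_abs)
  show "AE x in unit_measure. integrable unit_measure (\<lambda>y. case (x, y) of (x, y) \<Rightarrow> f x * g y)"
    using g by simp
qed

text \<open>A positive symmetric form \<open>B u v = \<langle>u, A v\<rangle>\<close> with \<open>B u u \<le> M \<langle>u, u\<rangle>\<close> forces
  \<open>\<parallel>A u\<parallel> \<le> M \<parallel>u\<parallel>\<close>: expand \<open>0 \<le> B w w\<close> at \<open>w = u - A u / M\<close>.\<close>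

lemma L2_onorm_le_of_quadratic_form:
  assumes M: "0 < M"
    and A: "\<And>u. u \<in> L2_unit \<Longrightarrow> A u \<in> L2_unit"
    and lin: "\<And>u v c x. u \<in> L2_unit \<Longrightarrow> v \<in> L2_unit \<Longrightarrow> x \<in> {0..1}
        \<Longrightarrow> A (\<lambda>x. u x - c * v x) x = A u x - c * A v x"
    and sym: "\<And>u v. u \<in> L2_unit \<Longrightarrow> v \<in> L2_unit \<Longrightarrow> L2_inner u (A v) = L2_inner v (A u)"
    and pos: "\<And>u. u \<in> L2_unit \<Longrightarrow> 0 \<le> L2_inner u (A u)"
    and le: "\<And>u. u \<in> L2_unit \<Longrightarrow> L2_inner u (A u) \<le> M * L2_inner u u"
    and u: "u \<in> L2_unit"
  shows "L2_norm (A u) \<le> M * L2_norm u"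
proof -
  let ?B = "\<lambda>u v. L2_inner u (A v)"
  define c where "c = 1 / M"
  define w where "w = (\<lambda>x. u x - c * A u x)"
  have Au: "A u \<in> L2_unit" and AAu: "A (A u) \<in> L2_unit" and w: "w \<in> L2_unit"
    using A u L2_unit_diff_scale unfolding w_def by blast+
  have "?B w w = L2_inner w (\<lambda>x. A u x - c * A (A u) x)"
    unfolding w_def using lin[OF u Au] by (intro L2_inner_cong) auto
  also have "\<dots> = L2_inner (A u) w - c * L2_inner (A (A u)) w"
    using L2_inner_diff_scale[OF Au AAu w] by (simp add: L2_inner_commute)
  also have "\<dots> = (L2_inner u (A u) - c * L2_inner (A u) (A u))
      - c * (L2_inner u (A (A u)) - c * L2_inner (A u) (A (A u)))"
    unfolding w_def
    using L2_inner_diff_scale[OF u Au Au] L2_inner_diff_scale[OF u Au AAu]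
    by (simp add: L2_inner_commute)
  also have "L2_inner u (A (A u)) = L2_inner (A u) (A u)"
    by (rule sym[OF u Au])
  finally have "0 \<le> ?B u u - 2 * c * L2_inner (A u) (A u) + c * (c * ?B (A u) (A u))"
    using pos[OF w] by (simp add: algebra_simps)
  also have "\<dots> \<le> M * L2_inner u u - 2 * c * L2_inner (A u) (A u)
      + c * (c * (M * L2_inner (A u) (A u)))"
    using le[OF u] le[OF Au] M by (intro add_mono diff_mono mult_left_mono) (auto simp: c_def)
  \<comment> \<open>With \<open>c = 1 / M\<close> the last term is
    \<open>c * L2_inner (A u) (A u)\<close>, which cancels half of the negative middle term.\<close>
  also have "\<dots> = M * L2_inner u u - c * L2_inner (A u) (A u)"
    using M by (simp add: c_def)
  finally have "c * L2_inner (A u) (A u) \<le> M * L2_inner u u" by simp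
  then have "L2_inner (A u) (A u) \<le> M\<^sup>2 * L2_inner u u"
    using M by (simp add: c_def field_simps power2_eq_square)
  then have "sqrt (L2_inner (A u) (A u)) \<le> sqrt (M\<^sup>2 * L2_inner u u)"
    by (rule real_sqrt_le_mono)
  then show ?thesis using M by (simp add: L2_norm_def real_sqrt_mult)
qed

section \<open>Degree and variance of a regular graphon\<close>

locale regular_graphon =
  fixes r :: "real \<Rightarrow> real \<Rightarrow> real" and \<delta> :: real
  assumes graphon: "graphon r"
    and cont: "continuous_on ({0..1} \<times> {0..1}) (\<lambda>(x, y). r x y)"
    and \<delta>_pos: "0 < \<delta>"
    and r_bounds: "\<And>x y. x \<in> {0..1} \<Longrightarrow> y \<in> {0..1} \<Longrightarrow> \<delta> \<le> r x y \<and> r x y \<le> 1 - \<delta>"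
begin

text \<open>A real supremum, convenient in arithmetic; \<open>Linf_norm_deg\<close> identifies it
  with the extended real essential supremum.\<close>

definition max_deg :: real where
  "max_deg = Sup (deg r ` {0..1})"

lemma r_measurable [measurable]:
  "(\<lambda>(x, y). r x y) \<in> borel_measurable (unit_measure \<Otimes>\<^sub>M unit_measure)"
  using graphon by (simp add: graphon_def)

lemma r_sym: "x \<in> {0..1} \<Longrightarrow> y \<in> {0..1} \<Longrightarrow> r x y = r y x"
  using graphon by (simp add: graphon_def)

lemma r_pos: "x \<in> {0..1} \<Longrightarrow> y \<in> {0..1} \<Longrightarrow> 0 < r x y"
  and r_less_1: "x \<in> {0..1} \<Longrightarrow> y \<in> {0..1} \<Longrightarrow> r x y < 1"
  using r_bounds \<delta>_pos by fastforce+

lemma cont_section: "x \<in> {0..1} \<Longrightarrow> continuous_on {0..1} (r x)"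
  by (rule continuous_on_section[OF cont])

lemma cont_deg: "continuous_on {0..1} (deg r)"
  unfolding deg_def by (rule continuous_on_integral_unit[OF cont])

lemma cont_var: "continuous_on {0..1} (var r)"
proof -
  have "continuous_on ({0..1} \<times> {0..1}) (\<lambda>(x, y). r x y * (1 - r x y))"
    using cont by (auto simp: case_prod_unfold intro!: continuous_intros)
  from continuous_on_integral_unit[OF this] show ?thesis by (simp add: var_def)
qed

lemma deg_bounds:
  assumes "x \<in> {0..1}"
  shows "\<delta> \<le> deg r x" "deg r x \<le> 1 - \<delta>"
proof -
  note i = integrable_unit_continuous[OF cont_section[OF assms]]
  have "(\<integral>y. \<delta> \<partial>unit_measure) \<le> deg r x"
    unfolding deg_def using r_bounds[OF assms] i by (intro integral_unit_mono) auto
  moreover have "deg r x \<le> (\<integral>y. 1 - \<delta> \<partial>unit_measure)"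
    unfolding deg_def using r_bounds[OF assms] i by (intro integral_unit_mono) auto
  ultimately show "\<delta> \<le> deg r x" "deg r x \<le> 1 - \<delta>" by auto
qed

lemma var_pos:
  assumes "x \<in> {0..1}"
  shows "0 < var r x"
proof -
  have "\<delta> * \<delta> \<le> r x y * (1 - r x y)" if "y \<in> {0..1}" for y
    using r_bounds[OF assms that] \<delta>_pos by (intro mult_mono) auto
  then have "(\<integral>y. \<delta> * \<delta> \<partial>unit_measure) \<le> var r x"
    unfolding var_def
    by (intro integral_unit_mono integrable_unit_continuous)
      (auto intro!: continuous_intros cont_section assms)
  moreover have "0 < \<delta> * \<delta>" using \<delta>_pos by simp
  ultimately show ?thesis by simp
qed

lemma deg_le_max_deg: "x \<in> {0..1} \<Longrightarrow> deg r x \<le> max_deg"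
  unfolding max_deg_def using deg_bounds(2) by (intro cSup_upper bdd_aboveI2) auto

lemma max_deg_attained: "\<exists>x\<in>{0..1}. deg r x = max_deg"
proof -
  obtain x where x: "x \<in> {0..1}" "\<And>y. y \<in> {0..1} \<Longrightarrow> deg r y \<le> deg r x"
    using continuous_attains_sup[OF _ _ cont_deg] by auto
  then have "max_deg \<le> deg r x"
    unfolding max_deg_def by (intro cSup_least) auto
  with x deg_le_max_deg show ?thesis by (meson antisym)
qed

lemma max_deg_bounds: "\<delta> \<le> max_deg" "max_deg \<le> 1 - \<delta>"
  using max_deg_attained deg_bounds by force+

text \<open>Provides an interval that is non-degenerate, hence not a null set, and short, hence
  nearly invisible to the integral operator. The first property serves the essential supremum, both
  serve the norm of the Laplacian.\<close>

lemma deg_near_max_deg: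
  assumes "0 < \<epsilon>"
  obtains a b where "0 \<le> a" "a < b" "b \<le> 1" "b - a \<le> \<epsilon>"
    "\<And>x. x \<in> {a..b} \<Longrightarrow> max_deg - \<epsilon> < deg r x"
proof -
  obtain x0 where x0: "x0 \<in> {0..1}" "deg r x0 = max_deg" using max_deg_attained by auto
  obtain \<eta> where \<eta>: "0 < \<eta>" "\<And>x. x \<in> {0..1} \<Longrightarrow> \<bar>x - x0\<bar> < \<eta> \<Longrightarrow> \<bar>deg r x - max_deg\<bar> < \<epsilon>"
    using cont_deg x0 assms unfolding continuous_on_iff dist_real_def by metis
  \<comment> \<open>Half of \<open>\<epsilon>\<close> on each side keeps the length at most
    \<open>\<epsilon>\<close>; the interval is clipped to \<open>{0..1}\<close> because the
    maximiser may be an endpoint.\<close>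
  define \<rho> where "\<rho> = min (\<eta> / 2) (\<epsilon> / 2)"
  have \<rho>: "0 < \<rho>" "\<rho> \<le> \<eta> / 2" "\<rho> \<le> \<epsilon> / 2" using \<eta> assms by (auto simp: \<rho>_def)
  show ?thesis
  proof (rule that[of "max 0 (x0 - \<rho>)" "min 1 (x0 + \<rho>)"])
    fix x assume x: "x \<in> {max 0 (x0 - \<rho>)..min 1 (x0 + \<rho>)}"
    then have "\<bar>x - x0\<bar> < \<eta>" "x \<in> {0..1}" using \<rho> \<eta>(1) by auto
    with \<eta>(2) show "max_deg - \<epsilon> < deg r x" by fastforce
  qed (use \<rho> x0 in auto)
qed

text \<open>Continuity makes the essential supremum a supremum: any level \<open>z\<close> below
  \<open>max_deg\<close> is exceeded on an interval of positive length.\<close>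

lemma Linf_norm_deg: "Linf_norm (deg r) = ereal max_deg"
proof (rule antisym)
  have m: "(\<lambda>x. ereal \<bar>deg r x\<bar>) \<in> borel_measurable unit_measure"
    using borel_measurable_unit[OF cont_deg] by simp
  show "Linf_norm (deg r) \<le> ereal max_deg"
    unfolding Linf_norm_def using deg_bounds(1) deg_le_max_deg \<delta>_pos
    by (intro esssup_I[OF m] AE_unit) (smt (verit) ereal_less_eq(3))
  show "ereal max_deg \<le> Linf_norm (deg r)"
  proof (rule ccontr)
    assume "\<not> ereal max_deg \<le> Linf_norm (deg r)"
    then have "Linf_norm (deg r) < ereal max_deg" by simp
    then obtain z where z: "Linf_norm (deg r) < ereal z" "ereal z < ereal max_deg"
      by (rule ereal_dense2[THEN exE]) auto
    then have "0 < max_deg - z" by simp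
    then obtain a b where ab: "0 \<le> a" "a < b" "b \<le> 1"
      "\<And>x. x \<in> {a..b} \<Longrightarrow> max_deg - (max_deg - z) < deg r x"
      using deg_near_max_deg by metis
    have "AE x in unit_measure. x \<notin> {a..b}"
      using esssup_AE[of "\<lambda>x. ereal \<bar>deg r x\<bar>" unit_measure]
    proof eventually_elim
      case (elim x)
      then have "ereal \<bar>deg r x\<bar> < ereal z"
        using z(1) unfolding Linf_norm_def by (rule le_less_trans)
      then show ?case using ab(4)[of x] by auto
    qed
    then have "measure unit_measure {a..b} = 0"
      using interval_in_sets_unit[OF ab(1,3)] unit.prob_eq_0 by blast
    then show False using ab by (simp add: measure_unit_interval)
  qed
qed

lemma max_deg_set_eq: "max_deg_set r = {x \<in> {0..1}. deg r x = max_deg}"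
  by (simp add: max_deg_set_def Linf_norm_deg)

section \<open>The integral operator and the Laplacian as quadratic forms\<close>

lemma abs_r_mult_le:
  assumes "x \<in> {0..1}" "y \<in> {0..1}"
  shows "\<bar>r x y * z\<bar> \<le> \<bar>z\<bar>"
  using mult_right_mono[of "r x y" 1 "\<bar>z\<bar>"] r_pos[OF assms] r_less_1[OF assms]
  by (simp add: abs_mult)

lemma kernel_integrable:
  assumes "integrable unit_measure u" "x \<in> {0..1}"
  shows "integrable unit_measure (\<lambda>y. r x y * u y)"
proof (rule Bochner_Integration.integrable_bound[OF assms(1)])
  show "(\<lambda>y. r x y * u y) \<in> borel_measurable unit_measure"
    using assms borel_measurable_unit[OF cont_section] by auto
  show "AE y in unit_measure. norm (r x y * u y) \<le> norm (u y)"
    using abs_r_mult_le[OF assms(2)] by (intro AE_unit) simp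
qed

text \<open>As \<open>r \<le> 1\<close>, the operator maps integrable functions to bounded ones.
  This places its values in \<open>L2_unit\<close> and makes them small for indicators of short
  intervals.\<close>

lemma kernel_op_bound:
  assumes "integrable unit_measure u" "x \<in> {0..1}"
  shows "\<bar>kernel_op r u x\<bar> \<le> (\<integral>y. \<bar>u y\<bar> \<partial>unit_measure)"
proof -
  have "\<bar>kernel_op r u x\<bar> \<le> (\<integral>y. \<bar>r x y * u y\<bar> \<partial>unit_measure)"
    unfolding kernel_op_def by (rule integral_abs_bound)
  also have "\<dots> \<le> (\<integral>y. \<bar>u y\<bar> \<partial>unit_measure)"
    using kernel_integrable[OF assms] assms(1) abs_r_mult_le[OF assms(2)]
    by (intro integral_unit_mono integrable_abs)
  finally show ?thesis .
qed

lemma kernel_op_measurable: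
  assumes [measurable]: "u \<in> borel_measurable unit_measure"
  shows "kernel_op r u \<in> borel_measurable unit_measure"
proof -
  have "(\<lambda>x. \<integral>y. r x y * u y \<partial>unit_measure) \<in> borel_measurable unit_measure"
    by (rule unit.borel_measurable_lebesgue_integral) measurable
  then show ?thesis by (simp add: kernel_op_def[abs_def])
qed

lemma kernel_op_L2:
  assumes "u \<in> L2_unit"
  shows "kernel_op r u \<in> L2_unit"
  using L2_unitD[OF assms] kernel_op_measurable kernel_op_bound by (intro L2_unit_bounded) auto

lemma kernel_op_one: "kernel_op r (\<lambda>_. 1) = deg r"
  by (simp add: kernel_op_def deg_def fun_eq_iff)

text \<open>Fubini's theorem and the symmetry of \<open>r\<close>, with
  \<open>\<bar>u x * v y\<bar>\<close> as dominating function. The assumption is integrability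
  because \<open>laplacian_op_pos\<close> takes the square of an \<open>L2_unit\<close> function for
  \<open>v\<close>.\<close>

lemma kernel_op_symmetric:
  assumes u: "integrable unit_measure u" and v: "integrable unit_measure v"
  shows "L2_inner u (kernel_op r v) = L2_inner v (kernel_op r u)"
proof -
  have [measurable]: "u \<in> borel_measurable unit_measure" "v \<in> borel_measurable unit_measure"
    using u v by auto
  have "integrable (unit_measure \<Otimes>\<^sub>M unit_measure) (\<lambda>(x, y). u x * (r x y * v y))"
  proof (rule Bochner_Integration.integrable_bound[OF integrable_pair_unit_mult[OF u v]])
    show "(\<lambda>(x, y). u x * (r x y * v y)) \<in> borel_measurable (unit_measure \<Otimes>\<^sub>M unit_measure)"
      by measurable
    have "\<bar>u x * (r x y * v y)\<bar> \<le> \<bar>u x * v y\<bar>" if "x \<in> {0..1}" "y \<in> {0..1}" for x y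
      using abs_r_mult_le[OF that, of "u x * v y"] by (simp add: mult_ac)
    then show "AE z in unit_measure \<Otimes>\<^sub>M unit_measure.
        norm (case z of (x, y) \<Rightarrow> u x * (r x y * v y)) \<le> norm (case z of (x, y) \<Rightarrow> u x * v y)"
      by (intro AE_I2) (auto simp: space_pair_measure)
  qed
  from unit_pair.Fubini_integral[OF this]
  have "(\<integral>y. (\<integral>x. u x * (r x y * v y) \<partial>unit_measure) \<partial>unit_measure)
      = (\<integral>x. (\<integral>y. u x * (r x y * v y) \<partial>unit_measure) \<partial>unit_measure)" .
  also have "\<dots> = L2_inner u (kernel_op r v)"
    by (simp add: L2_inner_def kernel_op_def)
  also have "(\<integral>y. (\<integral>x. u x * (r x y * v y) \<partial>unit_measure) \<partial>unit_measure)
      = (\<integral>y. (\<integral>x. v y * (r y x * u x) \<partial>unit_measure) \<partial>unit_measure)"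
    by (intro Bochner_Integration.integral_cong) (auto simp: r_sym)
  also have "\<dots> = L2_inner v (kernel_op r u)"
    by (simp add: L2_inner_def kernel_op_def)
  finally show ?thesis by simp
qed

lemma deg_mult_L2:
  assumes "u \<in> L2_unit"
  shows "(\<lambda>x. deg r x * u x) \<in> L2_unit"
proof -
  have m: "(\<lambda>x. deg r x * u x) \<in> borel_measurable unit_measure"
    using borel_measurable_unit[OF cont_deg] L2_unitD(1)[OF assms] by measurable
  have "integrable unit_measure (\<lambda>x. (deg r x * u x)\<^sup>2)"
  proof (rule Bochner_Integration.integrable_bound[OF L2_unitD(2)[OF assms]])
    have "(deg r x)\<^sup>2 \<le> 1" if "x \<in> {0..1}" for x
      using deg_bounds[OF that] \<delta>_pos by (intro power_le_one) auto
    then show "AE x in unit_measure. norm ((deg r x * u x)\<^sup>2) \<le> norm ((u x)\<^sup>2)"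
      by (intro AE_unit) (auto simp: power_mult_distrib intro!: mult_left_le_one_le)
  qed (use m in measurable)
  with m show ?thesis by (simp add: L2_unit_def)
qed

text \<open>The factor 1 gives the right-hand side the shape \<open>u x - c * v x\<close> that
  \<open>L2_unit_diff_scale\<close> and \<open>L2_inner_diff_scale\<close> expect.\<close>

lemma laplacian_op_eq:
  assumes "integrable unit_measure u" "x \<in> {0..1}"
  shows "laplacian_op r u x = deg r x * u x - 1 * kernel_op r u x"
proof -
  have "laplacian_op r u x = (\<integral>y. r x y * u x - r x y * u y \<partial>unit_measure)"
    by (simp add: laplacian_op_def right_diff_distrib)
  also have "\<dots> = deg r x * u x - kernel_op r u x"
    using kernel_integrable[OF assms] integrable_unit_continuous[OF cont_section[OF assms(2)]]
    by (simp add: deg_def kernel_op_def)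
  finally show ?thesis by simp
qed

lemma laplacian_op_L2:
  assumes "u \<in> L2_unit"
  shows "laplacian_op r u \<in> L2_unit"
proof -
  let ?g = "\<lambda>x. deg r x * u x - 1 * kernel_op r u x"
  have g: "?g \<in> L2_unit"
    using assms by (intro L2_unit_diff_scale deg_mult_L2 kernel_op_L2)
  have eq: "laplacian_op r u x = ?g x" if "x \<in> space unit_measure" for x
    using laplacian_op_eq[OF L2_unitD(3)[OF assms]] that by simp
  have "laplacian_op r u \<in> borel_measurable unit_measure"
    using L2_unitD(1)[OF g] measurable_cong[of unit_measure, OF eq] by simp
  moreover have "integrable unit_measure (\<lambda>x. (laplacian_op r u x)\<^sup>2)"
    using L2_unitD(2)[OF g] by (subst Bochner_Integration.integrable_cong[OF refl, of _ _ "\<lambda>x. (?g x)\<^sup>2"])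
      (use eq in auto)
  ultimately show ?thesis by (simp add: L2_unit_def)
qed

lemma L2_inner_laplacian_op:
  assumes "u \<in> L2_unit" "v \<in> L2_unit"
  shows "L2_inner u (laplacian_op r v)
    = L2_inner u (\<lambda>x. deg r x * v x) - L2_inner u (kernel_op r v)"
proof -
  have "L2_inner u (laplacian_op r v) = L2_inner u (\<lambda>x. deg r x * v x - 1 * kernel_op r v x)"
    using laplacian_op_eq[OF L2_unitD(3)[OF assms(2)]] by (intro L2_inner_cong) auto
  also have "\<dots> = L2_inner (\<lambda>x. deg r x * v x - 1 * kernel_op r v x) u"
    by (rule L2_inner_commute)
  also have "\<dots> = L2_inner (\<lambda>x. deg r x * v x) u - 1 * L2_inner (kernel_op r v) u"
    using assms by (intro L2_inner_diff_scale deg_mult_L2 kernel_op_L2)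
  finally show ?thesis by (simp add: L2_inner_commute)
qed

lemma laplacian_op_symmetric:
  assumes "u \<in> L2_unit" "v \<in> L2_unit"
  shows "L2_inner u (laplacian_op r v) = L2_inner v (laplacian_op r u)"
proof -
  have "L2_inner u (\<lambda>x. deg r x * v x) = L2_inner v (\<lambda>x. deg r x * u x)"
    by (simp add: L2_inner_def mult_ac)
  then show ?thesis
    using kernel_op_symmetric[OF L2_unitD(3)[OF assms(1)] L2_unitD(3)[OF assms(2)]]
    by (simp add: L2_inner_laplacian_op assms)
qed

text \<open>The form is a Dirichlet form, half the double integral of
  \<open>r x y * (u x - u y)\<^sup>2\<close>. The bound
  \<open>2 * (u x * u y) \<le> ?sq x + ?sq y\<close> is integrated against \<open>r\<close> one
  variable at a time; the two resulting halves agree because the symmetric operator maps 1 to the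
  degree.\<close>

lemma laplacian_op_pos:
  assumes u: "u \<in> L2_unit"
  shows "0 \<le> L2_inner u (laplacian_op r u)"
proof -
  let ?sq = "\<lambda>x. (u x)\<^sup>2"
  note sq = L2_unitD(2)[OF u] and int = L2_unitD(3)[OF u]
  have Tu: "integrable unit_measure (\<lambda>x. u x * kernel_op r u x)"
    by (intro L2_integrable_mult u kernel_op_L2)
  have du: "integrable unit_measure (\<lambda>x. deg r x * ?sq x)"
    using L2_integrable_mult[OF u deg_mult_L2[OF u]] by (simp add: power2_eq_square mult_ac)
  have Tsq: "integrable unit_measure (kernel_op r ?sq)"
    using kernel_op_measurable kernel_op_bound[OF sq] sq
    by (intro integrable_unit_bounded) auto
  have "u x * kernel_op r u x \<le> (deg r x * ?sq x + kernel_op r ?sq x) / 2" if x: "x \<in> {0..1}" for x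
  proof -
    have "2 * (u x * kernel_op r u x) = (\<integral>y. 2 * u x * (r x y * u y) \<partial>unit_measure)"
      by (simp add: kernel_op_def)
    also have "\<dots> \<le> (\<integral>y. r x y * ?sq x + r x y * ?sq y \<partial>unit_measure)"
    proof (rule integral_unit_mono)
      fix y :: real assume y: "y \<in> {0..1}"
      have "r x y * (2 * (u x * u y)) \<le> r x y * (?sq x + ?sq y)"
        using r_pos[OF x y] zero_le_power2[of "u x - u y"]
        by (intro mult_left_mono) (auto simp: power2_diff)
      then show "2 * u x * (r x y * u y) \<le> r x y * ?sq x + r x y * ?sq y"
        by (simp add: algebra_simps)
    qed (use x sq int kernel_integrable integrable_unit_continuous[OF cont_section[OF x]] in auto)
    also have "\<dots> = deg r x * ?sq x + kernel_op r ?sq x"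
      using kernel_integrable[OF sq x] integrable_unit_continuous[OF cont_section[OF x]]
      by (simp add: deg_def kernel_op_def)
    finally show ?thesis by simp
  qed
  then have "L2_inner u (kernel_op r u)
      \<le> (\<integral>x. (deg r x * ?sq x + kernel_op r ?sq x) / 2 \<partial>unit_measure)"
    unfolding L2_inner_def using Tu du Tsq by (intro integral_unit_mono) auto
  also have "\<dots> = ((\<integral>x. deg r x * ?sq x \<partial>unit_measure) + (\<integral>x. kernel_op r ?sq x \<partial>unit_measure)) / 2"
    using du Tsq by simp
  also have "(\<integral>x. kernel_op r ?sq x \<partial>unit_measure) = (\<integral>x. deg r x * ?sq x \<partial>unit_measure)"
    using kernel_op_symmetric[of "\<lambda>_. 1" ?sq] sq
    by (simp add: L2_inner_def kernel_op_one mult.commute)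
  also have "(\<integral>x. deg r x * ?sq x \<partial>unit_measure) = L2_inner u (\<lambda>x. deg r x * u x)"
    by (simp add: L2_inner_def power2_eq_square mult_ac)
  finally show ?thesis using L2_inner_laplacian_op[OF u u] by simp
qed

text \<open>Non-negative definiteness discards the integral operator from the form and leaves
  multiplication by the degree.\<close>

lemma laplacian_op_le:
  assumes "nonneg_definite (kernel_op r)" and u: "u \<in> L2_unit"
  shows "L2_inner u (laplacian_op r u) \<le> max_deg * L2_inner u u"
proof -
  have "L2_inner u (\<lambda>x. deg r x * u x) \<le> (\<integral>x. max_deg * (u x * u x) \<partial>unit_measure)"
    unfolding L2_inner_def
  proof (rule integral_unit_mono)
    fix x :: real assume x: "x \<in> {0..1}"
    have "deg r x * (u x * u x) \<le> max_deg * (u x * u x)"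
      using deg_le_max_deg[OF x] by (intro mult_right_mono) auto
    then show "u x * (deg r x * u x) \<le> max_deg * (u x * u x)" by (simp add: mult_ac)
  qed (use L2_integrable_mult u deg_mult_L2 in auto)
  moreover have "0 \<le> L2_inner u (kernel_op r u)"
    using assms by (simp add: nonneg_definite_def)
  ultimately show ?thesis
    using L2_inner_laplacian_op[OF u u] by (simp add: L2_inner_def)
qed

lemma laplacian_op_norm_le:
  assumes "nonneg_definite (kernel_op r)" "u \<in> L2_unit"
  shows "L2_norm (laplacian_op r u) \<le> max_deg * L2_norm u"
proof (rule L2_onorm_le_of_quadratic_form[where A = "laplacian_op r"])
  show "0 < max_deg" using max_deg_bounds \<delta>_pos by simp
  fix u v :: "real \<Rightarrow> real" and c x :: real
  assume u: "u \<in> L2_unit" and v: "v \<in> L2_unit" and x: "x \<in> {0..1}"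
  note iu = L2_unitD(3)[OF u] and iv = L2_unitD(3)[OF v]
  have "kernel_op r (\<lambda>x. u x - c * v x) x = (\<integral>y. r x y * u y - c * (r x y * v y) \<partial>unit_measure)"
    by (simp add: kernel_op_def algebra_simps)
  also have "\<dots> = kernel_op r u x - c * kernel_op r v x"
    using kernel_integrable[OF iu x] kernel_integrable[OF iv x] by (simp add: kernel_op_def)
  finally have "laplacian_op r (\<lambda>x. u x - c * v x) x
      = deg r x * (u x - c * v x) - (kernel_op r u x - c * kernel_op r v x)"
    using laplacian_op_eq[OF L2_unitD(3)[OF L2_unit_diff_scale[OF u v]] x] by simp
  also have "\<dots> = laplacian_op r u x - c * laplacian_op r v x"
    unfolding laplacian_op_eq[OF iu x] laplacian_op_eq[OF iv x] by (simp add: algebra_simps)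
  finally show "laplacian_op r (\<lambda>x. u x - c * v x) x = laplacian_op r u x - c * laplacian_op r v x" .
qed (use assms laplacian_op_L2 laplacian_op_symmetric laplacian_op_pos laplacian_op_le in auto)

lemma laplacian_op_quotient_le:
  assumes "nonneg_definite (kernel_op r)" "u \<in> L2_unit"
  shows "L2_norm (laplacian_op r u) / L2_norm u \<le> max_deg"
proof (cases "L2_norm u = 0")
  case True
  then show ?thesis using max_deg_bounds \<delta>_pos by simp
next
  case False
  then have "0 < L2_norm u" using L2_inner_self_nonneg[of u] by (simp add: L2_norm_def less_le)
  then show ?thesis using laplacian_op_norm_le[OF assms] by (simp add: divide_le_eq)
qed

text \<open>The norm is approached by indicators of short intervals around a point of maximal degree:
  there the integral part of the Laplacian is negligible against the multiplication part.\<close>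

lemma laplacian_op_quotient_ge:
  assumes e: "0 < \<epsilon>" "2 * \<epsilon> < max_deg"
  shows "\<exists>u\<in>L2_unit. max_deg - 2 * \<epsilon> \<le> L2_norm (laplacian_op r u) / L2_norm u"
proof -
  obtain a b where ab: "0 \<le> a" "a < b" "b \<le> 1" "b - a \<le> \<epsilon>"
    and d: "\<And>x. x \<in> {a..b} \<Longrightarrow> max_deg - \<epsilon> < deg r x"
    using deg_near_max_deg[OF e(1)] by metis
  define u :: "real \<Rightarrow> real" where "u = indicator {a..b}"
  \<comment> \<open>One \<open>\<epsilon>\<close> is lost in the degree on the interval and one to
    the integral operator; \<open>c\<close> is positive, so that the bound may be squared.\<close>
  define c where "c = max_deg - 2 * \<epsilon>"
  have sets: "{a..b} \<in> sets unit_measure" using ab by (intro interval_in_sets_unit)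
  have m: "u \<in> borel_measurable unit_measure" unfolding u_def using sets by simp
  have u: "u \<in> L2_unit"
    using m by (rule L2_unit_bounded[of _ 1]) (auto simp: u_def indicator_def)
  have "{a..b} \<inter> {0..1} = {a..b}" using ab by auto
  then have iu: "(\<integral>x. u x \<partial>unit_measure) = b - a"
    unfolding u_def using ab sets by (simp add: measure_unit_interval)
  have nu: "L2_inner u u = b - a"
    using iu by (simp add: L2_inner_def u_def indicator_inter_arith[symmetric])
  have ge: "c\<^sup>2 * u x \<le> laplacian_op r u x * laplacian_op r u x" if x: "x \<in> {0..1}" for x
  proof (cases "x \<in> {a..b}")
    case True
    have "\<bar>kernel_op r u x\<bar> \<le> (\<integral>y. \<bar>u y\<bar> \<partial>unit_measure)"
      by (rule kernel_op_bound[OF L2_unitD(3)[OF u] x])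
    also have "\<dots> = b - a" using iu by (simp add: u_def)
    finally have "kernel_op r u x \<le> \<epsilon>" using ab by linarith
    then have "c \<le> laplacian_op r u x"
      using d[OF True] True laplacian_op_eq[OF L2_unitD(3)[OF u] x] by (simp add: u_def c_def)
    then have "c\<^sup>2 \<le> (laplacian_op r u x)\<^sup>2" using e by (intro power_mono) (auto simp: c_def)
    then show ?thesis using True by (simp add: u_def power2_eq_square)
  qed (auto simp: u_def)
  have "c\<^sup>2 * L2_inner u u \<le> L2_inner (laplacian_op r u) (laplacian_op r u)"
  proof -
    have "c\<^sup>2 * L2_inner u u = (\<integral>x. c\<^sup>2 * u x \<partial>unit_measure)" by (simp add: nu iu)
    also have "\<dots> \<le> L2_inner (laplacian_op r u) (laplacian_op r u)"
      unfolding L2_inner_def using ge L2_unitD(3)[OF u] L2_integrable_mult laplacian_op_L2[OF u]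
      by (intro integral_unit_mono) auto
    finally show ?thesis .
  qed
  then have "sqrt (c\<^sup>2 * L2_inner u u) \<le> L2_norm (laplacian_op r u)"
    unfolding L2_norm_def by (rule real_sqrt_le_mono)
  moreover have "0 \<le> c" using e by (simp add: c_def)
  ultimately have "c * L2_norm u \<le> L2_norm (laplacian_op r u)"
    by (simp add: L2_norm_def real_sqrt_mult)
  moreover have "0 < L2_norm u" using nu ab by (simp add: L2_norm_def)
  ultimately have "c \<le> L2_norm (laplacian_op r u) / L2_norm u" by (simp add: le_divide_eq)
  with u show ?thesis by (auto simp: c_def)
qed

lemma C_eq_max_deg:
  assumes "nonneg_definite (kernel_op r)"
  shows "C r = max_deg"
proof (rule antisym)
  have ne: "L2_unit \<noteq> {}" using L2_unit_bounded[of "\<lambda>_. 0" 0] by auto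
  show "C r \<le> max_deg"
    unfolding C_def L2_onorm_def using ne laplacian_op_quotient_le[OF assms]
    by (intro cSUP_least)
  \<comment> \<open>The quotient bound also shows that the quotients are bounded above, as the real
    supremum in \<open>L2_onorm\<close> requires.\<close>
  have upper: "L2_norm (laplacian_op r u) / L2_norm u \<le> C r" if "u \<in> L2_unit" for u
    unfolding C_def L2_onorm_def using that laplacian_op_quotient_le[OF assms]
    by (intro cSUP_upper bdd_aboveI2)
  show "max_deg \<le> C r"
  proof (rule ccontr)
    assume "\<not> max_deg \<le> C r"
    \<comment> \<open>The first argument of the minimum yields the contradiction, the second the
      condition \<open>2 * \<epsilon> < max_deg\<close> of
      \<open>laplacian_op_quotient_ge\<close>.\<close>
    then have "0 < min (max_deg - C r) max_deg" using max_deg_bounds \<delta>_pos by simp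
    then obtain \<epsilon> where "0 < \<epsilon>" "2 * \<epsilon> < min (max_deg - C r) max_deg"
      by (metis dense zero_less_mult_pos zero_less_numeral field_sum_of_halves mult_2)
    then show False using laplacian_op_quotient_ge[of \<epsilon>] upper by fastforce
  qed
qed

end

section \<open>Asymptotics of the rate function\<close>

lemma compact_preimage_unit:
  fixes f :: "real \<Rightarrow> real"
  assumes "continuous_on {0..1} f" "closed B"
  shows "compact {x \<in> {0..1}. f x \<in> B}"
  using continuous_closed_preimage[OF assms(1) _ assms(2)]
  by (auto simp: compact_eq_bounded_closed vimage_def Int_def intro: bounded_subset[of "{0..1}"])

lemma tilt_zero [simp]: "tilt 0 p = p"
  by (simp add: tilt_def)

section \<open>The tilting parameter and duality for the rate function\<close>

context regular_graphon
begin

text \<open>Joint continuity makes the integral over \<open>y\<close> continuous in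
  \<open>t\<close>, as the intermediate value theorem requires.\<close>

lemma cont_tilt: "continuous_on (UNIV \<times> {0..1}) (\<lambda>(t, y). tilt t (r x y))" if x: "x \<in> {0..1}"
proof -
  have r: "continuous_on (UNIV \<times> {0..1}) (\<lambda>z. r x (snd z))"
    by (rule continuous_on_compose2[OF cont_section[OF x]]) (auto intro!: continuous_intros)
  show ?thesis
    unfolding tilt_def case_prod_unfold
    using cgf_arg_pos[OF r_pos[OF x] r_less_1[OF x]]
    by (intro continuous_intros r) (auto simp: less_imp_neq[symmetric])
qed

lemma cont_tilt_section: "x \<in> {0..1} \<Longrightarrow> continuous_on {0..1} (\<lambda>y. tilt t (r x y))"
  by (rule continuous_on_section[OF cont_tilt]) auto

lemma cont_cgf_section: "x \<in> {0..1} \<Longrightarrow> continuous_on {0..1} (\<lambda>y. cgf t (r x y))"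
  unfolding cgf_def using cgf_arg_pos[OF r_pos r_less_1]
  by (intro continuous_intros cont_section) (auto simp: less_imp_neq[symmetric])

text \<open>\<open>theta\<close> is a choice, so existence is the point: the mean of the tilted
  kernel moves continuously from the degree at \<open>t = 0\<close> to at least
  \<open>\<beta>\<close> at \<open>t = T\<close>.\<close>

lemma integral_tilt_theta:
  assumes x: "x \<in> {0..1}" and \<beta>: "deg r x < \<beta>" "\<beta> < 1"
  shows "(\<integral>y. tilt (theta r x \<beta>) (r x y) \<partial>unit_measure) = \<beta>"
proof -
  define g where "g = (\<lambda>t. \<integral>y. tilt t (r x y) \<partial>unit_measure)"
  \<comment> \<open>Chosen with \<open>exp T * (\<delta> * (1 - \<beta>)) = 1\<close>. For
    \<open>p \<ge> \<delta>\<close> this gives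
    \<open>\<beta> * (1 - p) \<le> 1 \<le> exp T * p * (1 - \<beta>)\<close>, which rearranges to
    \<open>\<beta> \<le> tilt T p\<close>.\<close>
  define T where "T = - ln (\<delta> * (1 - \<beta>))"
  have \<delta>1: "\<delta> \<le> 1" using r_bounds[OF x x] \<delta>_pos by simp
  have \<beta>0: "0 < \<beta>" using deg_bounds(1)[OF x] \<beta> \<delta>_pos by simp
  have p: "0 < \<delta> * (1 - \<beta>)" "\<delta> * (1 - \<beta>) \<le> 1"
    using \<delta>_pos \<delta>1 \<beta> \<beta>0 by (auto intro!: mult_le_one)
  have T: "0 \<le> T" using p by (simp add: T_def)
  have "continuous_on UNIV g"
    unfolding g_def by (rule continuous_on_integral_unit[OF cont_tilt[OF x]])
  then have c: "continuous_on {0..T} g" by (rule continuous_on_subset) simp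
  have "g 0 \<le> \<beta>" using \<beta> by (simp add: g_def deg_def)
  moreover have "\<beta> \<le> g T"
  proof -
    have "\<beta> \<le> tilt T (r x y)" if y: "y \<in> {0..1}" for y
    proof -
      let ?p = "r x y"
      have Z: "0 < exp T * ?p + (1 - ?p)" using r_pos r_less_1 x y by (intro cgf_arg_pos)
      have "exp T = inverse (\<delta> * (1 - \<beta>))" using p(1) by (simp only: T_def exp_minus exp_ln)
      then have eT: "exp T * (\<delta> * (1 - \<beta>)) = 1"
        using p(1) left_inverse[of "\<delta> * (1 - \<beta>)"] by (metis less_irrefl)
      have "1 - ?p \<le> 1" using r_pos[OF x y] by simp
      also have "1 \<le> exp T * (?p * (1 - \<beta>))"
        using eT r_bounds[OF x y] \<beta>
        by (metis diff_ge_0_iff_ge exp_ge_zero less_imp_le mult_left_mono mult_right_mono)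
      finally have "\<beta> * (1 - ?p) \<le> exp T * ?p * (1 - \<beta>)"
        using r_less_1[OF x y] \<beta> \<beta>0
        by (intro order_trans[OF mult_left_le_one_le]) (auto simp: mult_ac)
      then show ?thesis
        unfolding tilt_def using Z by (simp add: pos_le_divide_eq algebra_simps)
    qed
    then have "(\<integral>y. \<beta> \<partial>unit_measure) \<le> g T"
      unfolding g_def by (intro integral_unit_mono integrable_unit_continuous cont_tilt_section x) auto
    then show ?thesis by simp
  qed
  ultimately have "\<exists>t. 0 \<le> t \<and> t \<le> T \<and> g t = \<beta>" by (intro IVT' T c)
  then have "\<exists>t. (\<integral>y. tilt t (r x y) \<partial>unit_measure) = \<beta>" by (auto simp: g_def)
  then show ?thesis unfolding theta_def by (rule someI_ex)
qed

text \<open>Young's inequality integrated along the section at \<open>x\<close>: the equality case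
  at \<open>theta r x \<beta>\<close> gives the second claim, an arbitrary \<open>t\<close> the
  lower bound.\<close>

lemma J_ge_legendre:
  assumes x: "x \<in> {0..1}" and \<beta>: "deg r x < \<beta>" "\<beta> < 1"
  shows "t * \<beta> - (\<integral>y. cgf t (r x y) \<partial>unit_measure) \<le> J r x \<beta>"
    and "J r x \<beta> = theta r x \<beta> * \<beta> - (\<integral>y. cgf (theta r x \<beta>) (r x y) \<partial>unit_measure)"
proof -
  let ?\<theta> = "theta r x \<beta>"
  let ?q = "\<lambda>y. tilt ?\<theta> (r x y)"
  \<comment> \<open>The tilted kernel has mean \<open>\<beta>\<close>, so the linear term integrates
    to \<open>s * \<beta>\<close> for every \<open>s\<close>, not only for
    \<open>?\<theta>\<close>.\<close>
  have lin: "(\<integral>y. s * ?q y - cgf s (r x y) \<partial>unit_measure) = s * \<beta> - (\<integral>y. cgf s (r x y) \<partial>unit_measure)" for s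
    using integral_tilt_theta[OF assms]
      integrable_unit_continuous[OF cont_tilt_section[OF x]]
      integrable_unit_continuous[OF cont_cgf_section[OF x]] by simp
  have J: "J r x \<beta> = (\<integral>y. ?\<theta> * ?q y - cgf ?\<theta> (r x y) \<partial>unit_measure)"
    unfolding J_def r_hat_def using \<beta> r_pos[OF x] r_less_1[OF x]
    by (intro Bochner_Integration.integral_cong) (auto simp: rel_entropy_tilt)
  then show "J r x \<beta> = ?\<theta> * \<beta> - (\<integral>y. cgf ?\<theta> (r x y) \<partial>unit_measure)" by (simp add: lin)
  have "(\<integral>y. t * ?q y - cgf t (r x y) \<partial>unit_measure) \<le> J r x \<beta>"
    unfolding J
  proof (rule integral_unit_mono)
    fix y :: real assume y: "y \<in> {0..1}"
    note p = r_pos[OF x y] r_less_1[OF x y]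
    show "t * ?q y - cgf t (r x y) \<le> ?\<theta> * ?q y - cgf ?\<theta> (r x y)"
      using rel_entropy_ge_legendre[OF p tilt_bounds[OF p]] rel_entropy_tilt[OF p] by simp
  qed (intro integrable_unit_continuous continuous_intros cont_tilt_section cont_cgf_section x)+
  then show "t * \<beta> - (\<integral>y. cgf t (r x y) \<partial>unit_measure) \<le> J r x \<beta>" by (simp add: lin)
qed

text \<open>The dual bound combined with \<open>cgf_le_cubic\<close>. The error
  \<open>4 * t ^ 3\<close> is the same for all \<open>x\<close>, as the infimum over
  \<open>x\<close> requires.\<close>

lemma J_ge_quadratic:
  assumes x: "x \<in> {0..1}" and \<beta>: "deg r x < \<beta>" "\<beta> < 1" and t: "0 \<le> t" "t \<le> 1"
  shows "t * (\<beta> - deg r x) - t\<^sup>2 / 2 * var r x - 4 * t ^ 3 \<le> J r x \<beta>"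
proof -
  have "(\<integral>y. cgf t (r x y) \<partial>unit_measure)
      \<le> (\<integral>y. t * r x y + t\<^sup>2 / 2 * (r x y * (1 - r x y)) + 4 * t ^ 3 \<partial>unit_measure)"
    using r_pos[OF x] r_less_1[OF x] t
    by (intro integral_unit_mono cgf_le_cubic integrable_unit_continuous continuous_intros
        cont_cgf_section cont_section x)
  also have "\<dots> = t * deg r x + t\<^sup>2 / 2 * var r x + 4 * t ^ 3"
  proof -
    have "integrable unit_measure (r x)" "integrable unit_measure (\<lambda>y. r x y * (1 - r x y))"
      by (intro integrable_unit_continuous continuous_intros cont_section x)+
    then show ?thesis by (simp add: deg_def var_def)
  qed
  finally show ?thesis using J_ge_legendre(1)[OF x \<beta>, of t] by (simp add: right_diff_distrib)
qed

text \<open>The minimiser of the quadratic approximation of the relative entropy under the constraint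
  on the mean is \<open>r + h r (1 - r)\<close>; as a competitor it bounds the minimal entropy from above.\<close>

lemma J_le_quadratic:
  assumes x: "x \<in> {0..1}" and h: "0 < h" "h < 1" and \<beta>: "\<beta> = deg r x + h * var r x" "\<beta> < 1"
  shows "J r x \<beta> \<le> h\<^sup>2 / 2 * var r x + h ^ 3"
proof -
  let ?\<theta> = "theta r x \<beta>"
  let ?v = "\<lambda>y. r x y * (1 - r x y)"
  let ?q = "\<lambda>y. r x y + h * ?v y"
  have \<beta>': "deg r x < \<beta>" using var_pos[OF x] h \<beta> by simp
  note p = r_pos[OF x] r_less_1[OF x]
  have q: "0 < ?q y \<and> ?q y < 1" if y: "y \<in> {0..1}" for y
  proof
    have v: "0 < ?v y" using p[OF y] by simp
    then show "0 < ?q y" using p(1)[OF y] h by (simp add: add_pos_pos)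
    have "h * ?v y < 1 * ?v y" using h v by (intro mult_strict_right_mono)
    also have "1 * ?v y \<le> 1 - r x y" using p[OF y] by (simp add: mult_left_le_one_le)
    finally show "?q y < 1" by simp
  qed
  have iv: "integrable unit_measure (r x)" "integrable unit_measure ?v"
    by (intro integrable_unit_continuous continuous_intros cont_section x)+
  have qint: "(\<integral>y. ?q y \<partial>unit_measure) = \<beta>"
    using iv by (simp add: \<beta> deg_def var_def)
  have "J r x \<beta> = ?\<theta> * \<beta> - (\<integral>y. cgf ?\<theta> (r x y) \<partial>unit_measure)"
    by (rule J_ge_legendre(2)[OF x \<beta>' \<beta>(2)])
  \<comment> \<open>The competitor \<open>?q\<close> has the same mean \<open>\<beta>\<close> as the
    tilted kernel, so it may replace it in the linear term; Young's inequality at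
    \<open>?\<theta>\<close> then compares \<open>J\<close> with the entropy of
    \<open>?q\<close>.\<close>
  also have "\<dots> = (\<integral>y. ?\<theta> * ?q y - cgf ?\<theta> (r x y) \<partial>unit_measure)"
    using qint iv integrable_unit_continuous[OF cont_cgf_section[OF x]] by simp
  also have "\<dots> \<le> (\<integral>y. h\<^sup>2 / 2 * ?v y + h ^ 3 \<partial>unit_measure)"
  proof (rule integral_unit_mono)
    fix y :: real assume y: "y \<in> {0..1}"
    show "?\<theta> * ?q y - cgf ?\<theta> (r x y) \<le> h\<^sup>2 / 2 * ?v y + h ^ 3"
      using rel_entropy_ge_legendre[OF p[OF y], of "?q y" ?\<theta>] q[OF y]
        rel_entropy_le_cubic[OF p[OF y], of h] h by linarith
  qed (intro integrable_unit_continuous continuous_intros cont_section cont_cgf_section x)+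
  also have "\<dots> = h\<^sup>2 / 2 * var r x + h ^ 3"
    using iv by (simp add: var_def)
  finally show ?thesis .
qed

section \<open>Sharp two-sided bounds near the maximal degree\<close>

lemma K_hat_eq:
  obtains x0 where "x0 \<in> {0..1}" "deg r x0 = max_deg" "K_hat r = 1 / (2 * var r x0)"
    "\<And>x. x \<in> {0..1} \<Longrightarrow> deg r x = max_deg \<Longrightarrow> var r x \<le> var r x0"
proof -
  have "compact (max_deg_set r)"
    using compact_preimage_unit[OF cont_deg, of "{max_deg}"] by (simp add: max_deg_set_eq)
  moreover have "max_deg_set r \<noteq> {}" using max_deg_attained by (auto simp: max_deg_set_eq)
  moreover have "continuous_on (max_deg_set r) (var r)"
    by (rule continuous_on_subset[OF cont_var]) (auto simp: max_deg_set_eq)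
  ultimately obtain x0 where x0: "x0 \<in> max_deg_set r"
    and max: "\<And>x. x \<in> max_deg_set r \<Longrightarrow> var r x \<le> var r x0"
    using continuous_attains_sup by metis
  have pos: "0 < var r x" if "x \<in> max_deg_set r" for x
    using that var_pos by (simp add: max_deg_set_eq)
  have "(INF x\<in>max_deg_set r. 1 / var r x) = 1 / var r x0"
    using x0 max pos by (intro cInf_eq_minimum) (auto intro!: divide_left_mono)
  then have "K_hat r = 1 / (2 * var r x0)" by (simp add: K_hat_def)
  then show ?thesis using that x0 max by (auto simp: max_deg_set_eq)
qed

lemma psi_hat_asymp:
  "((\<lambda>\<beta>. psi_hat r \<beta> / (K_hat r * (\<beta> - max_deg)\<^sup>2)) \<longlongrightarrow> 1) (at_right max_deg)"
proof -
  obtain x0 where x0: "x0 \<in> {0..1}" "deg r x0 = max_deg" "K_hat r = 1 / (2 * var r x0)"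
    and max: "\<And>x. x \<in> {0..1} \<Longrightarrow> deg r x = max_deg \<Longrightarrow> var r x \<le> var r x0"
    using K_hat_eq by metis
  define V where "V = var r x0"
  have V: "0 < V" unfolding V_def by (rule var_pos[OF x0(1)])
  define F where "F = (\<lambda>\<beta>. psi_hat r \<beta> / (K_hat r * (\<beta> - max_deg)\<^sup>2))"
  have F: "F \<beta> = psi_hat r \<beta> * (2 * V / (\<beta> - max_deg)\<^sup>2)" for \<beta>
    by (simp add: F_def x0(3) V_def)
  have deg_less: "deg r x < \<beta>" if "x \<in> {0..1}" "max_deg < \<beta>" for x \<beta>
    using deg_le_max_deg[OF that(1)] that(2) by simp
  have ev: "\<forall>\<^sub>F \<beta> in at_right max_deg. \<beta> < c" if "max_deg < c" for c
    using that by (rule eventually_at_rightI[rotated]) auto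
  have ev_gt: "\<forall>\<^sub>F \<beta> in at_right max_deg. max_deg < \<beta>"
    by (rule eventually_at_right_less)
  have M1: "max_deg < 1" using max_deg_bounds \<delta>_pos by simp
  have MV: "max_deg < max_deg + V" using V by simp
  have upper: "F \<beta> \<le> 1 + 2 / V\<^sup>2 * (\<beta> - max_deg)"
    if \<beta>: "max_deg < \<beta>" "\<beta> < 1" "\<beta> < max_deg + V" for \<beta>
  proof -
    let ?\<epsilon> = "\<beta> - max_deg"
    \<comment> \<open>This value makes \<open>max_deg + t * V = \<beta>\<close>, so the competitor
      of \<open>J_le_quadratic\<close> at \<open>x0\<close> has the prescribed mean.\<close>
    define t where "t = ?\<epsilon> / V"
    have t: "0 < t" "t < 1" and \<epsilon>: "?\<epsilon> = t * V"
      using \<beta> V by (auto simp: t_def field_simps)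
    have "psi_hat r \<beta> \<le> J r x0 \<beta>"
      unfolding psi_hat_def
    proof (rule cINF_lower[OF bdd_belowI2 x0(1)])
      fix x :: real assume "x \<in> {0..1}"
      then show "0 \<le> J r x \<beta>"
        \<comment> \<open>At \<open>t = 0\<close> the lower bound reads
          \<open>0 \<le> J r x \<beta>\<close>, so the infimum is over a set bounded below.\<close>
        using J_ge_quadratic[of x \<beta> 0] deg_less \<beta> by simp
    qed
    also have "\<dots> \<le> t\<^sup>2 / 2 * V + t ^ 3"
      using J_le_quadratic[OF x0(1) t, of \<beta>] \<beta>(2) \<epsilon> x0(2) by (simp add: V_def[symmetric])
    finally have "F \<beta> \<le> (t\<^sup>2 / 2 * V + t ^ 3) * (2 * V / ?\<epsilon>\<^sup>2)"
      unfolding F using V by (intro mult_right_mono) auto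
    also have "\<dots> = 1 + 2 / V\<^sup>2 * ?\<epsilon>"
      unfolding \<epsilon> using V t by (simp add: field_simps power2_eq_square power3_eq_cube)
    finally show ?thesis .
  qed
  have lower: "\<forall>\<^sub>F \<beta> in at_right max_deg. 1 - \<eta> / V - 8 / V\<^sup>2 * (\<beta> - max_deg) \<le> F \<beta>"
    if \<eta>: "0 < \<eta>" for \<eta>
  proof -
    \<comment> \<open>Off \<open>S\<close> the variance exceeds \<open>V\<close> by less than
      \<open>\<eta>\<close>. On the compact set \<open>S\<close> no point has maximal degree, so a
      degree gap \<open>\<kappa>\<close> pays for the large variance once
      \<open>t \<le> \<kappa>\<close>.\<close>
    define S where "S = {x \<in> {0..1}. V + \<eta> \<le> var r x}"
    have "compact S"
      using compact_preimage_unit[OF cont_var, of "{V + \<eta>..}"] by (simp add: S_def)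
    have "\<exists>\<kappa>>0. \<forall>x\<in>S. deg r x \<le> max_deg - \<kappa>"
    proof (cases "S = {}")
      case True
      then show ?thesis by (auto intro: exI[of _ 1])
    next
      case False
      have "continuous_on S (deg r)"
        by (rule continuous_on_subset[OF cont_deg]) (auto simp: S_def)
      then obtain x1 where x1: "x1 \<in> S" "\<And>x. x \<in> S \<Longrightarrow> deg r x \<le> deg r x1"
        using continuous_attains_sup[OF \<open>compact S\<close> False] by metis
      have "deg r x1 \<noteq> max_deg" using max[of x1] x1(1) \<eta> by (auto simp: S_def V_def)
      with deg_le_max_deg[of x1] x1(1) have "deg r x1 < max_deg" by (auto simp: S_def)
      with x1(2) show ?thesis by (intro exI[of _ "max_deg - deg r x1"]) auto
    qed
    then obtain \<kappa> where \<kappa>: "0 < \<kappa>" "\<And>x. x \<in> S \<Longrightarrow> deg r x \<le> max_deg - \<kappa>" by auto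
    have var1: "var r x \<le> 1" if x: "x \<in> {0..1}" for x
    proof -
      have "var r x \<le> (\<integral>y. 1 \<partial>unit_measure)"
        unfolding var_def
      proof (rule integral_unit_mono)
        fix y :: real assume y: "y \<in> {0..1}"
        show "r x y * (1 - r x y) \<le> 1"
          using r_pos[OF x y] r_less_1[OF x y] by (intro mult_le_one) auto
      qed (intro integrable_unit_continuous continuous_intros cont_section x)+
      then show ?thesis by simp
    qed
    have \<kappa>V: "max_deg < max_deg + V * \<kappa>" using V \<kappa>(1) by simp
    show ?thesis
      using ev_gt ev[OF M1] ev[OF MV] ev[OF \<kappa>V]
    proof eventually_elim
      case (elim \<beta>)
      let ?\<epsilon> = "\<beta> - max_deg"
      \<comment> \<open>The maximiser of \<open>t * ?\<epsilon> - t\<^sup>2 / 2 * V\<close>, used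
        for all \<open>x\<close> alike.\<close>
      define t where "t = ?\<epsilon> / V"
      have t: "0 < t" "t \<le> 1" "t \<le> \<kappa>" and \<epsilon>: "?\<epsilon> = t * V"
        using elim V by (auto simp: t_def field_simps)
      have "t\<^sup>2 / 2 * (V - \<eta>) - 4 * t ^ 3 \<le> psi_hat r \<beta>"
        unfolding psi_hat_def
      proof (rule cINF_greatest)
        fix x :: real assume x: "x \<in> {0..1}"
        \<comment> \<open>The lower bound for \<open>J r x \<beta>\<close> reduces, after division
          by \<open>t\<close>, to this comparison of excess variance with degree gap. On
          \<open>S\<close> the left side is at most \<open>t \<le> \<kappa>\<close>, off
          \<open>S\<close> it is at most 0.\<close>
        have "t / 2 * (var r x - V - \<eta>) \<le> max_deg - deg r x"
        proof (cases "x \<in> S")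
          case True
          have "t / 2 * (var r x - V - \<eta>) \<le> t / 2 * 2"
            using var1[OF x] V \<eta> t by (intro mult_left_mono) auto
          also have "\<dots> \<le> max_deg - deg r x" using t \<kappa>(2)[OF True] by simp
          finally show ?thesis .
        next
          case False
          then have "t / 2 * (var r x - V - \<eta>) \<le> 0"
            using t x by (intro mult_nonneg_nonpos) (auto simp: S_def)
          then show ?thesis using deg_le_max_deg[OF x] by simp
        qed
        then have "t * (t / 2 * (var r x - V - \<eta>)) \<le> t * (max_deg - deg r x)"
          using t by (intro mult_left_mono) auto
        moreover have "t * (\<beta> - deg r x) = t\<^sup>2 * V + t * (max_deg - deg r x)"
          using \<epsilon> by (simp add: algebra_simps power2_eq_square)
        moreover have "t * (t / 2 * (var r x - V - \<eta>)) - t\<^sup>2 / 2 * var r x + t\<^sup>2 * V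
            = t\<^sup>2 / 2 * (V - \<eta>)"
          by (simp add: field_simps power2_eq_square)
        ultimately show "t\<^sup>2 / 2 * (V - \<eta>) - 4 * t ^ 3 \<le> J r x \<beta>"
          using J_ge_quadratic[OF x deg_less[OF x elim(1)], of t] elim t by linarith
      qed simp
      then have "(t\<^sup>2 / 2 * (V - \<eta>) - 4 * t ^ 3) * (2 * V / ?\<epsilon>\<^sup>2) \<le> F \<beta>"
        unfolding F using V by (intro mult_right_mono) auto
      also have "(t\<^sup>2 / 2 * (V - \<eta>) - 4 * t ^ 3) * (2 * V / ?\<epsilon>\<^sup>2) = 1 - \<eta> / V - 8 / V\<^sup>2 * ?\<epsilon>"
        unfolding \<epsilon> using V t by (simp add: field_simps power2_eq_square power3_eq_cube)
      finally show ?case .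
    qed
  qed
  \<comment> \<open>Both bounds for \<open>F\<close> are affine in \<open>\<beta> - max_deg\<close>,
    so only their constant terms survive in the limit.\<close>
  have lim: "((\<lambda>\<beta>. a + b * (\<beta> - max_deg)) \<longlongrightarrow> a) (at_right max_deg)" for a b :: real
    by (auto intro!: tendsto_eq_intros)
  have "(F \<longlongrightarrow> 1) (at_right max_deg)"
  proof (rule order_tendstoI)
    fix a :: real assume a: "a < 1"
    \<comment> \<open>Then \<open>1 - \<eta> / V = (1 + a) / 2\<close>, which lies strictly above
      \<open>a\<close>.\<close>
    define \<eta> where "\<eta> = V * (1 - a) / 2"
    have \<eta>: "0 < \<eta>" using V a by (simp add: \<eta>_def)
    have quot: "\<eta> / V = (1 - a) / 2" using V by (simp add: \<eta>_def)
    have a_less: "a < 1 - \<eta> / V" unfolding quot using a by (simp add: field_simps)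
    from order_tendstoD(1)[OF lim a_less, of "- (8 / V\<^sup>2)"] lower[OF \<eta>]
    show "\<forall>\<^sub>F \<beta> in at_right max_deg. a < F \<beta>"
      by eventually_elim simp
  next
    fix a :: real assume a: "1 < a"
    from order_tendstoD(2)[OF lim a, of "2 / V\<^sup>2"] ev_gt ev[OF M1] ev[OF MV]
    show "\<forall>\<^sub>F \<beta> in at_right max_deg. F \<beta> < a"
      by eventually_elim (rule le_less_trans[OF upper])
  qed
  then show ?thesis by (simp add: F_def)
qed

end

theorem theorem7:
  fixes r :: "real \<Rightarrow> real \<Rightarrow> real"
  assumes "graphon r"
    and "continuous_on ({0..1} \<times> {0..1}) (\<lambda>(x, y). r x y)"
    and "\<exists>\<delta>>0. \<forall>x\<in>{0..1}. \<forall>y\<in>{0..1}. \<delta> \<le> r x y \<and> r x y \<le> 1 - \<delta>"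
    and "nonneg_definite (kernel_op r)"
  shows "((\<lambda>\<beta>. psi_hat r \<beta> / (K_hat r * (\<beta> - C r)\<^sup>2)) \<longlongrightarrow> 1) (at_right (C r))"
proof -
  obtain \<delta> where \<delta>: "0 < \<delta>" "\<forall>x\<in>{0..1}. \<forall>y\<in>{0..1}. \<delta> \<le> r x y \<and> r x y \<le> 1 - \<delta>"
    using assms(3) by auto
  interpret regular_graphon r \<delta>
    using assms(1,2) \<delta> by unfold_locales auto
  show ?thesis
    unfolding C_eq_max_deg[OF assms(4)] by (rule psi_hat_asymp)
qed

end
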